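(* Let $A,B\in\mathbb{R}$ and let $d\geq 1$ be an integer. The space of K-symmetric potentials of degree $d$ is real $(3d-2)/2$-dimensional if $d$ is even, and real $(3d+1)/2$-dimensional if $d$ is odd.
   Context: For $A,B\in\mathbb{R}$ and $\lambda\in\mathbb{C}^\ast$ the K-matrix is $$K(\lambda)=\begin{pmatrix}4A-4B\lambda & \lambda-\lambda^{-1}\\ \lambda-\lambda^{-1} & 4A-4B\lambda^{-1}\end{pmatrix}.$$ A (finite-gap) potential of degree $d$ is a Laurent polynomial $\xi_\lambda=\sum_{k=-1}^{d}\hat\xi_k\lambda^k$ with $\hat\xi_k\in\mathrm{sl}_2(\mathbb{C})$ satisfying the reality condition $\hat\xi_k=-\overline{\hat\xi_{d-k-1}}^{\,t}$ for $-1\le k\le d$, and $\hat\xi_{-1}=\begin{pmatrix}0&c\\0&0\end{pmatrix}$ with $c\in i\mathbb{R}_+$ (positive imaginary). (In the absence of K-symmetry, the potentials of degree $d$ form an open subset of a real vector space of dimension $3d+1$ for $d$ even and $3d$ for $d$ odd; dimension of the space of K-symmetric potentials is understood in the same sense, as an open subset of a real vector space.) The potential $\xi_\lambda$ is K-symmetric if $K(\lambda)\,\xi_\lambda+\overline{\xi_{\bar\lambda}}^{\,t}K(\lambda)=0$ for all $\lambda\in\mathbb{C}^\ast$, where $\overline{\xi_{\bar\lambda}}^{\,t}=\sum_k\overline{\hat\xi_k}^{\,t}\lambda^k$.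
   Formalization: For even d the formal theorem also assumes A + B ≠ 0: if d is even and A + B = 0 (e.g. d = 2, A = B = 0, where the dimension is 4, not 2), the space of K-symmetric potentials has real dimension (3d+2)/2, so the claim as stated fails there. *)

theory Defs
  imports "HOL-Analysis.Analysis" "HOL-Analysis.Finite_Function_Topology"
begin

text \<open>
  A matrix-valued Laurent polynomial is the finitely supported map from exponents to
  coefficients; this type is a real normed vector space by \<^theory>\<open>HOL-Analysis.Finite_Function_Topology\<close>.
\<close>

type_synonym laurent = "int \<Rightarrow>\<^sub>0 complex^2^2"

definition laurent_eval :: "laurent \<Rightarrow> complex \<Rightarrow> complex^2^2" where
  "laurent_eval \<xi> z =
     (\<chi> i j. \<Sum>k\<in>Poly_Mapping.keys \<xi>. (z powi k) * (Poly_Mapping.lookup \<xi> k $ i $ j))"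

definition conj_transpose :: "complex^2^2 \<Rightarrow> complex^2^2" where
  "conj_transpose M = (\<chi> i j. cnj (M $ j $ i))"

definition sl2 :: "(complex^2^2) set" where
  "sl2 = {M. trace M = 0}"

definition K_matrix :: "real \<Rightarrow> real \<Rightarrow> complex \<Rightarrow> complex^2^2" where
  "K_matrix A B z =
     vector [vector [4 * complex_of_real A - 4 * complex_of_real B * z, z - inverse z],
             vector [z - inverse z, 4 * complex_of_real A - 4 * complex_of_real B * inverse z]]"

definition potentials :: "nat \<Rightarrow> laurent set" where
  "potentials d = {\<xi>.
     Poly_Mapping.keys \<xi> \<subseteq> {-1..int d} \<and>
     (\<forall>k\<in>{-1..int d}. Poly_Mapping.lookup \<xi> k \<in> sl2) \<and>
     (\<forall>k\<in>{-1..int d}. Poly_Mapping.lookup \<xi> k =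
        - conj_transpose (Poly_Mapping.lookup \<xi> (int d - k - 1))) \<and>
     (\<exists>r::real. r > 0 \<and>
        Poly_Mapping.lookup \<xi> (-1) = vector [vector [0, \<i> * complex_of_real r], vector [0, 0]])}"

text \<open>
  Evaluating at the conjugate of \<open>z\<close> before taking the conjugate transpose yields the Laurent
  polynomial whose coefficients are the conjugate transposes of those of \<open>\<xi>\<close>.
\<close>

definition K_symmetric :: "real \<Rightarrow> real \<Rightarrow> laurent \<Rightarrow> bool" where
  "K_symmetric A B \<xi> \<longleftrightarrow> (\<forall>z. z \<noteq> 0 \<longrightarrow>
     K_matrix A B z ** laurent_eval \<xi> z
       + conj_transpose (laurent_eval \<xi> (cnj z)) ** K_matrix A B z = 0)"

definition K_symmetric_potentials :: "real \<Rightarrow> real \<Rightarrow> nat \<Rightarrow> laurent set" where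
  "K_symmetric_potentials A B d = {\<xi> \<in> potentials d. K_symmetric A B \<xi>}"

text \<open>
  \<open>S\<close> is a nonempty open subset of an \<open>n\<close>-dimensional real vector space. Nonemptiness makes \<open>n\<close>
  unique, since the ambient subspace is then the span of \<open>S\<close>. Dimension is stated by means of a
  finite basis because \<^const>\<open>dim\<close> is \<open>0\<close> on infinite-dimensional spaces.
\<close>

definition real_dimensional :: "nat \<Rightarrow> 'a::real_normed_vector set \<Rightarrow> bool" where
  "real_dimensional n S \<longleftrightarrow> S \<noteq> {} \<and>
     (\<exists>b. finite b \<and> independent b \<and> card b = n \<and> openin (top_of_set (span b)) S)"

end

theory Submission
  imports Defs
begin

text \<open>
  By the reality condition a potential is determined by its entries \<open>a\<close> (upper left) and \<open>b\<close>
  (upper right). Write \<open>p\<close>, \<open>s\<close>, \<open>q\<close> for the entries of \<open>K\<close>, write \<open>f~(\<lambda>) = \<lambda>\<^sup>d\<^sup>-\<^sup>1 f(1/\<lambda>)\<close>, and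
  take real and imaginary parts coefficientwise. Then \<open>(Re a)~ = - Re a\<close> and \<open>(Im a)~ = Im a\<close>, and
  \<open>K\<close>-symmetry splits into \<open>s Re b = q Re a\<close> and \<open>2 s Im a = p Im b - q (Im b)~\<close>. So \<open>Re a\<close>
  determines \<open>Re b\<close> and \<open>Im b\<close> determines \<open>Im a\<close>, subject to the right-hand sides being divisible
  by \<open>s = \<lambda>\<^sup>-\<^sup>1 (\<lambda>\<^sup>2 - 1)\<close>. By antisymmetry under \<open>~\<close> they vanish at \<open>\<lambda> = 1\<close>, and for odd \<open>d\<close> also at
  \<open>\<lambda> = -1\<close>; for even \<open>d\<close> vanishing at \<open>-1\<close> means \<open>(A + B) (Re a)(-1) = 0\<close> and
  \<open>(A + B) (Im b)(-1) = 0\<close>, one linear condition on each part. Counting the free coefficients of the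
  antisymmetric \<open>Re a\<close> and of \<open>Im b\<close> gives the dimension.
\<close>

section \<open>Coefficients as bounded linear maps on Laurent polynomials\<close>

lemma lookup_scaleR_poly_mapping:
  fixes x :: "'a \<Rightarrow>\<^sub>0 'b::real_vector"
  shows "Poly_Mapping.lookup (c *\<^sub>R x) k = c *\<^sub>R Poly_Mapping.lookup x k"
proof -
  have "finite {k. c *\<^sub>R Poly_Mapping.lookup x k \<noteq> 0}"
    by (rule finite_subset[OF _ finite_lookup[of x]]) auto
  then show ?thesis by (simp add: scaleR_poly_mapping_def)
qed

text \<open>The norm is the sum of the norms of all coefficients, and this is one of its
  terms.\<close>

lemma norm_lookup_le:
  fixes x :: "'a \<Rightarrow>\<^sub>0 'b::real_normed_vector"
  shows "norm (Poly_Mapping.lookup x k) \<le> norm x"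
proof (cases "k \<in> Poly_Mapping.keys x")
  case True
  then show ?thesis
    unfolding norm_poly_mapping_def dist_poly_mapping_def
    using member_le_sum[of k "Poly_Mapping.keys x" "\<lambda>k. norm (Poly_Mapping.lookup x k)"] by simp
qed (simp add: in_keys_iff)

lemma bounded_linear_lookup:
  "bounded_linear (\<lambda>x :: 'a \<Rightarrow>\<^sub>0 'b::real_normed_vector. Poly_Mapping.lookup x k)"
  by (rule bounded_linear_intro[where K = 1])
     (simp_all add: lookup_add lookup_scaleR_poly_mapping norm_lookup_le)

section \<open>A basis from triangular coordinates\<close>

text \<open>Induction on \<open>n\<close> by passing to the kernel of \<open>f 0\<close>:
  triangularity puts \<open>e 1, e 2, ...\<close> into this kernel, and \<open>e 0\<close>, which
  lies outside it, supplies the missing direction. The last hypothesis says that the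
  \<open>f i\<close> separate the points of \<open>V\<close>, so \<open>V\<close> is zero when no
  coordinate is left.\<close>

lemma triangular_coordinates_basis:
  fixes V :: "'a::real_vector set" and f :: "nat \<Rightarrow> 'a \<Rightarrow> real"
  assumes "subspace V"
    and "\<And>i. i < n \<Longrightarrow> e i \<in> V"
    and "\<And>i. i < n \<Longrightarrow> linear (f i)"
    and "\<And>i. i < n \<Longrightarrow> f i (e i) \<noteq> 0"
    and "\<And>i j. i < n \<Longrightarrow> j < i \<Longrightarrow> f j (e i) = 0"
    and "\<And>x. x \<in> V \<Longrightarrow> \<forall>i<n. f i x = 0 \<Longrightarrow> x = 0"
  shows "\<exists>b. finite b \<and> independent b \<and> card b = n \<and> span b = V"
  using assms
proof (induction n arbitrary: V e f)
  case 0
  then have "V = {0}" using subspace_0 by blast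
  then show ?case by (intro exI[of _ "{}"]) (simp add: independent_empty)
next
  case (Suc n)
  let ?V = "{x \<in> V. f 0 x = 0}"
  have lin: "linear (f 0)" using Suc.prems(3) by simp
  have nz: "f 0 (e 0) \<noteq> 0" using Suc.prems(4) by simp
  have "\<exists>b. finite b \<and> independent b \<and> card b = n \<and> span b = ?V"
  proof (rule Suc.IH[where e = "\<lambda>i. e (Suc i)" and f = "\<lambda>i. f (Suc i)"])
    show "subspace ?V"
      using Suc.prems(1) lin
      by (auto simp: subspace_def linear_0 linear_add linear_scale)
    show "x = 0" if "x \<in> ?V" "\<forall>i<n. f (Suc i) x = 0" for x
      using that Suc.prems(6)[of x] by (auto simp: less_Suc_eq_0_disj)
  qed (use Suc.prems in auto)
  then obtain b where b: "finite b" "independent b" "card b = n" "span b = ?V" by blast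
  have notin: "e 0 \<notin> span b" using b nz by simp
  have "span (insert (e 0) b) = V"
  proof
    have "insert (e 0) b \<subseteq> V" using b(4) span_superset[of b] Suc.prems(2) by auto
    then show "span (insert (e 0) b) \<subseteq> V" using Suc.prems(1) span_minimal by blast
    show "V \<subseteq> span (insert (e 0) b)"
    proof
      fix x assume x: "x \<in> V"
      let ?y = "x - (f 0 x / f 0 (e 0)) *\<^sub>R e 0"
      have "?y \<in> ?V"
        using x nz Suc.prems(1) Suc.prems(2)[of 0] lin
        by (simp add: linear_diff linear_scale subspace_diff subspace_scale)
      then show "x \<in> span (insert (e 0) b)"
        using b(4) by (auto simp: span_insert)
    qed
  qed
  moreover have "independent (insert (e 0) b)"
    using b notin by (simp add: independent_insertI)
  moreover have "card (insert (e 0) b) = Suc n"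
    using b(1,3) span_base[of "e 0" b] notin by (auto simp: card_insert_if)
  ultimately show ?case using b(1) by (intro exI[of _ "insert (e 0) b"]) auto
qed

section \<open>K-symmetry as equations between coefficients\<close>

text \<open>The range of exponents exceeds that of a potential by one at each end, which leaves room
  for the shifts caused by the entries of \<open>K\<close>.\<close>

definition laurent_sum :: "nat \<Rightarrow> (int \<Rightarrow> complex) \<Rightarrow> complex \<Rightarrow> complex" where
  "laurent_sum d f z = (\<Sum>k\<in>{-2..int d + 1}. z powi k * f k)"

lemma laurent_sum_add: "laurent_sum d f z + laurent_sum d g z = laurent_sum d (\<lambda>k. f k + g k) z"
  by (simp add: laurent_sum_def sum.distrib ring_distribs)

lemma laurent_sum_diff: "laurent_sum d f z - laurent_sum d g z = laurent_sum d (\<lambda>k. f k - g k) z"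
  by (simp add: laurent_sum_def sum_subtractf ring_distribs)

lemma laurent_sum_cmult: "c * laurent_sum d f z = laurent_sum d (\<lambda>k. c * f k) z"
  by (simp add: laurent_sum_def sum_distrib_left mult_ac)

lemma laurent_sum_shift_up:
  assumes "z \<noteq> 0" "\<And>k. k \<notin> {-1..int d} \<Longrightarrow> f k = 0"
  shows "z * laurent_sum d f z = laurent_sum d (\<lambda>k. f (k - 1)) z"
proof -
  have "z * laurent_sum d f z = (\<Sum>k\<in>{-2..int d + 1}. z powi (k + 1) * f k)"
    using assms(1) by (simp add: laurent_sum_def sum_distrib_left power_int_add mult_ac)
  also have "\<dots> = (\<Sum>k\<in>{-2..int d}. z powi (k + 1) * f k)"
    using assms(2) by (intro sum.mono_neutral_right) auto
  also have "\<dots> = (\<Sum>k\<in>{-1..int d + 1}. z powi k * f (k - 1))"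
    by (rule sum.reindex_bij_witness[of _ "\<lambda>k. k - 1" "\<lambda>k. k + 1"]) auto
  also have "\<dots> = laurent_sum d (\<lambda>k. f (k - 1)) z"
    unfolding laurent_sum_def using assms(2) by (intro sum.mono_neutral_left) auto
  finally show ?thesis .
qed

lemma laurent_sum_shift_down:
  assumes "z \<noteq> 0" "\<And>k. k \<notin> {-1..int d} \<Longrightarrow> f k = 0"
  shows "inverse z * laurent_sum d f z = laurent_sum d (\<lambda>k. f (k + 1)) z"
proof -
  have "inverse z * laurent_sum d f z = (\<Sum>k\<in>{-2..int d + 1}. z powi (k - 1) * f k)"
    using assms(1) by (simp add: laurent_sum_def sum_distrib_left power_int_diff field_simps)
  also have "\<dots> = (\<Sum>k\<in>{-1..int d + 1}. z powi (k - 1) * f k)"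
    using assms(2) by (intro sum.mono_neutral_right) auto
  also have "\<dots> = (\<Sum>k\<in>{-2..int d}. z powi k * f (k + 1))"
    by (rule sum.reindex_bij_witness[of _ "\<lambda>k. k + 1" "\<lambda>k. k - 1"]) auto
  also have "\<dots> = laurent_sum d (\<lambda>k. f (k + 1)) z"
    unfolding laurent_sum_def using assms(2) by (intro sum.mono_neutral_left) auto
  finally show ?thesis .
qed

lemma laurent_sum_eq_0_iff:
  "(\<forall>z. z \<noteq> 0 \<longrightarrow> laurent_sum d f z = 0) \<longleftrightarrow> (\<forall>k\<in>{-2..int d + 1}. f k = 0)"
proof
  assume *: "\<forall>z. z \<noteq> 0 \<longrightarrow> laurent_sum d f z = 0"
  let ?c = "\<lambda>i::nat. f (int i - 2)"
  \<comment> \<open>Multiplication by \<open>z ^ 2\<close> clears the negative exponents and gives a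
    polynomial of degree at most \<open>d + 3\<close> with infinitely many roots.\<close>
  have "(\<Sum>i\<le>d + 3. ?c i * z ^ i) = 0" if "z \<noteq> 0" for z
  proof -
    have "(\<Sum>i\<le>d + 3. ?c i * z ^ i) = (\<Sum>k\<in>{-2..int d + 1}. z powi (k + 2) * f k)"
      by (rule sum.reindex_bij_witness[of _ "\<lambda>k. nat (k + 2)" "\<lambda>i. int i - 2"]) auto
    also have "\<dots> = z ^ 2 * laurent_sum d f z"
      using that by (simp add: laurent_sum_def sum_distrib_left power_int_add mult_ac)
    finally show ?thesis using * that by simp
  qed
  then have "UNIV - {0} \<subseteq> {z. (\<Sum>i\<le>d + 3. ?c i * z ^ i) = 0}" by auto
  moreover have "infinite (UNIV - {0 :: complex})"
    by (simp add: infinite_UNIV_char_0)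
  ultimately have "\<not> finite {z. (\<Sum>i\<le>d + 3. ?c i * z ^ i) = 0}"
    using finite_subset by blast
  then have c: "\<forall>i\<le>d + 3. ?c i = 0" using polyfun_finite_roots[of ?c] by blast
  show "\<forall>k\<in>{-2..int d + 1}. f k = 0"
  proof
    fix k assume "k \<in> {-2..int d + 1}"
    then have "nat (k + 2) \<le> d + 3" "int (nat (k + 2)) - 2 = k" by auto
    then show "f k = 0" using c by metis
  qed
qed (simp add: laurent_sum_def)

lemma laurent_eval_nth:
  assumes "Poly_Mapping.keys \<xi> \<subseteq> {-1..int d}"
  shows "laurent_eval \<xi> z $ i $ j = laurent_sum d (\<lambda>k. Poly_Mapping.lookup \<xi> k $ i $ j) z"
  using assms unfolding laurent_eval_def laurent_sum_def
  by (auto simp: in_keys_iff intro!: sum.mono_neutral_left)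

lemma cnj_laurent_sum: "cnj (laurent_sum d f (cnj z)) = laurent_sum d (\<lambda>k. cnj (f k)) z"
  by (simp add: laurent_sum_def)

lemma K_entries_laurent_sum:
  assumes z: "z \<noteq> 0" and f: "\<And>k. k \<notin> {-1..int d} \<Longrightarrow> f k = 0"
  shows "(4 * A - 4 * B * z) * laurent_sum d f z = laurent_sum d (\<lambda>k. 4 * A * f k - 4 * B * f (k - 1)) z"
    and "(4 * A - 4 * B * inverse z) * laurent_sum d f z = laurent_sum d (\<lambda>k. 4 * A * f k - 4 * B * f (k + 1)) z"
    and "(z - inverse z) * laurent_sum d f z = laurent_sum d (\<lambda>k. f (k - 1) - f (k + 1)) z"
proof -
  have up: "z * laurent_sum d f z = laurent_sum d (\<lambda>k. f (k - 1)) z"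
    by (rule laurent_sum_shift_up) (use z f in auto)
  have down: "inverse z * laurent_sum d f z = laurent_sum d (\<lambda>k. f (k + 1)) z"
    by (rule laurent_sum_shift_down) (use z f in auto)
  show "(4 * A - 4 * B * z) * laurent_sum d f z = laurent_sum d (\<lambda>k. 4 * A * f k - 4 * B * f (k - 1)) z"
    "(4 * A - 4 * B * inverse z) * laurent_sum d f z = laurent_sum d (\<lambda>k. 4 * A * f k - 4 * B * f (k + 1)) z"
    "(z - inverse z) * laurent_sum d f z = laurent_sum d (\<lambda>k. f (k - 1) - f (k + 1)) z"
    by (simp_all only: left_diff_distrib mult.assoc[of _ z] mult.assoc[of _ "inverse z"] up down)
       (simp_all only: laurent_sum_cmult laurent_sum_diff)
qed

text \<open>Each entry of the matrix equation is a Laurent polynomial in \<open>z\<close> and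
  vanishes exactly when its coefficients do. The four conjuncts belong to the entries (1,1), (2,2),
  (1,2) and (2,1), in this order.\<close>

lemma K_symmetric_iff:
  fixes \<xi> :: laurent and A B :: real
  defines "x \<equiv> \<lambda>i j k. Poly_Mapping.lookup \<xi> k $ i $ j"
  assumes keys: "Poly_Mapping.keys \<xi> \<subseteq> {-1..int d}"
  shows "K_symmetric A B \<xi> \<longleftrightarrow> (\<forall>k\<in>{-2..int d + 1}.
     4 * of_real A * (x 1 1 k + cnj (x 1 1 k)) - 4 * of_real B * (x 1 1 (k - 1) + cnj (x 1 1 (k - 1)))
       + ((x 2 1 (k - 1) + cnj (x 2 1 (k - 1))) - (x 2 1 (k + 1) + cnj (x 2 1 (k + 1)))) = 0 \<and>
     4 * of_real A * (x 2 2 k + cnj (x 2 2 k)) - 4 * of_real B * (x 2 2 (k + 1) + cnj (x 2 2 (k + 1)))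
       + ((x 1 2 (k - 1) + cnj (x 1 2 (k - 1))) - (x 1 2 (k + 1) + cnj (x 1 2 (k + 1)))) = 0 \<and>
     4 * of_real A * x 1 2 k - 4 * of_real B * x 1 2 (k - 1) + (4 * of_real A * cnj (x 2 1 k) - 4 * of_real B * cnj (x 2 1 (k + 1)))
       + ((x 2 2 (k - 1) + cnj (x 1 1 (k - 1))) - (x 2 2 (k + 1) + cnj (x 1 1 (k + 1)))) = 0 \<and>
     4 * of_real A * cnj (x 1 2 k) - 4 * of_real B * cnj (x 1 2 (k - 1)) + (4 * of_real A * x 2 1 k - 4 * of_real B * x 2 1 (k + 1))
       + ((cnj (x 2 2 (k - 1)) + x 1 1 (k - 1)) - (cnj (x 2 2 (k + 1)) + x 1 1 (k + 1))) = 0)"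
    (is "_ \<longleftrightarrow> (\<forall>k\<in>_. ?a k = 0 \<and> ?b k = 0 \<and> ?c k = 0 \<and> ?d k = 0)")
proof -
  have supp: "x i j k = 0" if "k \<notin> {-1..int d}" for i j k
    proof -
    have "k \<notin> Poly_Mapping.keys \<xi>" using that keys by blast
    then show ?thesis by (simp add: x_def in_keys_iff)
  qed
  have M: "(K_matrix A B z ** laurent_eval \<xi> z
       + conj_transpose (laurent_eval \<xi> (cnj z)) ** K_matrix A B z = 0) \<longleftrightarrow>
     laurent_sum d ?a z = 0 \<and> laurent_sum d ?b z = 0 \<and> laurent_sum d ?c z = 0 \<and> laurent_sum d ?d z = 0"
    if z: "z \<noteq> 0" for z
  proof -
    have ev: "laurent_eval \<xi> w $ i $ j = laurent_sum d (x i j) w" for w i j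
      using laurent_eval_nth[OF keys] by (simp add: x_def)
    have cj: "conj_transpose (laurent_eval \<xi> (cnj z)) $ i $ j = laurent_sum d (\<lambda>k. cnj (x j i k)) z" for i j
      by (simp add: conj_transpose_def ev cnj_laurent_sum)
    have E: "(4 * of_real A - 4 * of_real B * z) * laurent_sum d f z = laurent_sum d (\<lambda>k. 4 * of_real A * f k - 4 * of_real B * f (k - 1)) z"
      "(4 * of_real A - 4 * of_real B * inverse z) * laurent_sum d f z = laurent_sum d (\<lambda>k. 4 * of_real A * f k - 4 * of_real B * f (k + 1)) z"
      "(z - inverse z) * laurent_sum d f z = laurent_sum d (\<lambda>k. f (k - 1) - f (k + 1)) z"
      if "\<forall>k. k \<notin> {-1..int d} \<longrightarrow> f k = 0" for f :: "int \<Rightarrow> complex"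
      by (rule K_entries_laurent_sum; use z that in auto)+
    have s1: "\<forall>k. k \<notin> {-1..int d} \<longrightarrow> x i j k = 0"
      and s2: "\<forall>k. k \<notin> {-1..int d} \<longrightarrow> cnj (x i j k) = 0" for i j
      using supp by auto
    note E1 = E[OF s1] and E2 = E[OF s2]
    let ?M = "K_matrix A B z ** laurent_eval \<xi> z
       + conj_transpose (laurent_eval \<xi> (cnj z)) ** K_matrix A B z"
    have K: "K_matrix A B z $ 1 $ 1 = 4 * of_real A - 4 * of_real B * z" "K_matrix A B z $ 1 $ 2 = z - inverse z"
      "K_matrix A B z $ 2 $ 1 = z - inverse z" "K_matrix A B z $ 2 $ 2 = 4 * of_real A - 4 * of_real B * inverse z"
      by (simp_all add: K_matrix_def)
    have M: "?M $ i $ j = K_matrix A B z $ i $ 1 * laurent_sum d (x 1 j) z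
        + K_matrix A B z $ i $ 2 * laurent_sum d (x 2 j) z
        + (K_matrix A B z $ 1 $ j * laurent_sum d (\<lambda>k. cnj (x 1 i k)) z
        + K_matrix A B z $ 2 $ j * laurent_sum d (\<lambda>k. cnj (x 2 i k)) z)" for i j
      by (simp add: matrix_matrix_mult_def sum_2 ev cj mult.commute)
    have "?M $ 1 $ 1 = laurent_sum d ?a z" "?M $ 2 $ 2 = laurent_sum d ?b z"
      "?M $ 1 $ 2 = laurent_sum d ?c z" "?M $ 2 $ 1 = laurent_sum d ?d z"
      unfolding M K E1 E2 laurent_sum_add
      by (intro arg_cong[where f = "\<lambda>f. laurent_sum d f z"] ext; simp add: algebra_simps)+
    then show ?thesis
      unfolding vec_eq_iff[of ?M] vec_eq_iff[of "?M $ _"] forall_2 by auto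
  qed
  show ?thesis
    unfolding K_symmetric_def using M
      laurent_sum_eq_0_iff[of d ?a] laurent_sum_eq_0_iff[of d ?b]
      laurent_sum_eq_0_iff[of d ?c] laurent_sum_eq_0_iff[of d ?d]
    by (smt (verit))
qed

section \<open>The real vector space containing the K-symmetric potentials\<close>

text \<open>The lower left entry is forced by the reality condition, the lower right one by trace
  zero.\<close>

definition potential_coeff :: "nat \<Rightarrow> (int \<Rightarrow> complex) \<Rightarrow> (int \<Rightarrow> complex) \<Rightarrow> int \<Rightarrow> complex^2^2" where
  "potential_coeff d a b k = vector [vector [a k, b k], vector [- cnj (b (int d - 1 - k)), - a k]]"

lemma potential_coeff_nth [simp]:
  "potential_coeff d a b k $ 1 $ 1 = a k"
  "potential_coeff d a b k $ 1 $ 2 = b k"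
  "potential_coeff d a b k $ 2 $ 1 = - cnj (b (int d - 1 - k))"
  "potential_coeff d a b k $ 2 $ 2 = - a k"
  by (simp_all add: potential_coeff_def)

text \<open>These are real-linear conditions; only the positivity of \<open>Im (b (-1))\<close> is
  left out. In the notation \<open>p\<close>, \<open>s\<close>, \<open>q\<close>, \<open>~\<close>
  introduced above, the last three clauses compare coefficients in \<open>s Re b = q Re a\<close>,
  \<open>p Re b = q (Re b)~\<close> and \<open>2 s Im a = p Im b - q (Im b)~\<close>. Since
  \<open>a\<close> and \<open>b\<close> have bounded support, the equations can be stated for all
  \<open>k\<close>.\<close>

definition admissible_entries :: "real \<Rightarrow> real \<Rightarrow> nat \<Rightarrow> (int \<Rightarrow> complex) \<Rightarrow> (int \<Rightarrow> complex) \<Rightarrow> bool" where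
  "admissible_entries A B d a b \<longleftrightarrow>
     (\<forall>k. k \<notin> {0..int d - 1} \<longrightarrow> a k = 0) \<and>
     (\<forall>k. k \<notin> {-1..int d - 1} \<longrightarrow> b k = 0) \<and>
     Re (b (-1)) = 0 \<and>
     (\<forall>k. a k = - cnj (a (int d - 1 - k))) \<and>
     (\<forall>k. Re (b (k - 1)) - Re (b (k + 1)) = 4 * A * Re (a k) - 4 * B * Re (a (k + 1))) \<and>
     (\<forall>k. A * (Re (b k) - Re (b (int d - 1 - k))) = B * (Re (b (k - 1)) - Re (b (int d - 2 - k)))) \<and>
     (\<forall>k. Im (a (k - 1)) - Im (a (k + 1)) =
        2 * A * (Im (b k) - Im (b (int d - 1 - k))) - 2 * B * (Im (b (k - 1)) - Im (b (int d - 2 - k))))"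

definition symmetric_space :: "real \<Rightarrow> real \<Rightarrow> nat \<Rightarrow> laurent set" where
  "symmetric_space A B d = {\<xi>. \<exists>a b. admissible_entries A B d a b \<and> Poly_Mapping.lookup \<xi> = potential_coeff d a b}"

lemma admissible_entriesD:
  assumes "admissible_entries A B d a b"
  shows "k \<notin> {0..int d - 1} \<Longrightarrow> a k = 0"
    and "k \<notin> {-1..int d - 1} \<Longrightarrow> b k = 0"
    and "Re (b (-1)) = 0"
    and "a k = - cnj (a (int d - 1 - k))"
    and "Re (b (k - 1)) - Re (b (k + 1)) = 4 * A * Re (a k) - 4 * B * Re (a (k + 1))"
    and "A * (Re (b k) - Re (b (int d - 1 - k))) = B * (Re (b (k - 1)) - Re (b (int d - 2 - k)))"
    and "Im (a (k - 1)) - Im (a (k + 1)) =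
        2 * A * (Im (b k) - Im (b (int d - 1 - k))) - 2 * B * (Im (b (k - 1)) - Im (b (int d - 2 - k)))"
  using assms unfolding admissible_entries_def by blast+

lemma admissible_entries_add:
  assumes "admissible_entries A B d a b" "admissible_entries A B d a' b'"
  shows "admissible_entries A B d (\<lambda>k. a k + a' k) (\<lambda>k. b k + b' k)"
  unfolding admissible_entries_def
proof (intro conjI allI impI)
  note D = admissible_entriesD[OF assms(1)] and D' = admissible_entriesD[OF assms(2)]
  show "k \<notin> {0..int d - 1} \<Longrightarrow> a k + a' k = 0" "k \<notin> {-1..int d - 1} \<Longrightarrow> b k + b' k = 0"
    "Re (b (-1) + b' (-1)) = 0" for k
    using D(1,2,3) D'(1,2,3) by simp_all
  show "a k + a' k = - cnj (a (int d - 1 - k) + a' (int d - 1 - k))" for k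
    using D(4)[of k] D'(4)[of k] by simp
  show "Re (b (k - 1) + b' (k - 1)) - Re (b (k + 1) + b' (k + 1)) =
      4 * A * Re (a k + a' k) - 4 * B * Re (a (k + 1) + a' (k + 1))" for k
    using D(5)[of k] D'(5)[of k] by (simp add: algebra_simps)
  show "A * (Re (b k + b' k) - Re (b (int d - 1 - k) + b' (int d - 1 - k))) =
      B * (Re (b (k - 1) + b' (k - 1)) - Re (b (int d - 2 - k) + b' (int d - 2 - k)))" for k
    using D(6)[of k] D'(6)[of k] by (simp add: algebra_simps)
  show "Im (a (k - 1) + a' (k - 1)) - Im (a (k + 1) + a' (k + 1)) =
      2 * A * (Im (b k + b' k) - Im (b (int d - 1 - k) + b' (int d - 1 - k))) -
      2 * B * (Im (b (k - 1) + b' (k - 1)) - Im (b (int d - 2 - k) + b' (int d - 2 - k)))" for k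
    using D(7)[of k] D'(7)[of k] by (simp add: algebra_simps)
qed

lemma admissible_entries_scaleR:
  assumes "admissible_entries A B d a b"
  shows "admissible_entries A B d (\<lambda>k. c *\<^sub>R a k) (\<lambda>k. c *\<^sub>R b k)"
  unfolding admissible_entries_def
proof (intro conjI allI impI)
  note D = admissible_entriesD[OF assms]
  show "k \<notin> {0..int d - 1} \<Longrightarrow> c *\<^sub>R a k = 0" "k \<notin> {-1..int d - 1} \<Longrightarrow> c *\<^sub>R b k = 0"
    "Re (c *\<^sub>R b (-1)) = 0" for k
    using D(1,2,3) by simp_all
  show "c *\<^sub>R a k = - cnj (c *\<^sub>R a (int d - 1 - k))" for k
    using D(4)[of k] by simp
  show "Re (c *\<^sub>R b (k - 1)) - Re (c *\<^sub>R b (k + 1)) =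
      4 * A * Re (c *\<^sub>R a k) - 4 * B * Re (c *\<^sub>R a (k + 1))" for k
    using arg_cong[OF D(5)[of k], of "(*) c"] by (simp add: algebra_simps)
  show "A * (Re (c *\<^sub>R b k) - Re (c *\<^sub>R b (int d - 1 - k))) =
      B * (Re (c *\<^sub>R b (k - 1)) - Re (c *\<^sub>R b (int d - 2 - k)))" for k
    using arg_cong[OF D(6)[of k], of "(*) c"] by (simp add: algebra_simps)
  show "Im (c *\<^sub>R a (k - 1)) - Im (c *\<^sub>R a (k + 1)) =
      2 * A * (Im (c *\<^sub>R b k) - Im (c *\<^sub>R b (int d - 1 - k))) -
      2 * B * (Im (c *\<^sub>R b (k - 1)) - Im (c *\<^sub>R b (int d - 2 - k)))" for k
    using arg_cong[OF D(7)[of k], of "(*) c"] by (simp add: algebra_simps)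
qed

lemma subspace_symmetric_space: "subspace (symmetric_space A B d)"
proof (rule subspaceI)
  show "0 \<in> symmetric_space A B d"
    unfolding symmetric_space_def admissible_entries_def
    by (intro CollectI exI[of _ "\<lambda>k. 0"]) (auto simp: vec_eq_iff forall_2 potential_coeff_def)
next
  fix x y assume "x \<in> symmetric_space A B d" "y \<in> symmetric_space A B d"
  then obtain a b a' b' where *: "admissible_entries A B d a b" "Poly_Mapping.lookup x = potential_coeff d a b"
    "admissible_entries A B d a' b'" "Poly_Mapping.lookup y = potential_coeff d a' b'"
    unfolding symmetric_space_def by blast
  have "Poly_Mapping.lookup (x + y) = potential_coeff d (\<lambda>k. a k + a' k) (\<lambda>k. b k + b' k)"
    by (auto simp: fun_eq_iff lookup_add * vec_eq_iff forall_2)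
  moreover have "admissible_entries A B d (\<lambda>k. a k + a' k) (\<lambda>k. b k + b' k)"
    using *(1,3) by (rule admissible_entries_add)
  ultimately show "x + y \<in> symmetric_space A B d" unfolding symmetric_space_def by blast
next
  fix c x assume "x \<in> symmetric_space A B d"
  then obtain a b where *: "admissible_entries A B d a b" "Poly_Mapping.lookup x = potential_coeff d a b"
    unfolding symmetric_space_def by blast
  have "Poly_Mapping.lookup (c *\<^sub>R x) = potential_coeff d (\<lambda>k. c *\<^sub>R a k) (\<lambda>k. c *\<^sub>R b k)"
    by (auto simp: fun_eq_iff lookup_scaleR_poly_mapping * vec_eq_iff forall_2)
  moreover have "admissible_entries A B d (\<lambda>k. c *\<^sub>R a k) (\<lambda>k. c *\<^sub>R b k)"
    using *(1) by (rule admissible_entries_scaleR)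
  ultimately show "c *\<^sub>R x \<in> symmetric_space A B d" unfolding symmetric_space_def by blast
qed

text \<open>Positivity of the leading coefficient is the only condition on a K-symmetric potential
  that is not real-linear, so the potentials form an open half of a subspace.\<close>

lemma K_symmetric_potentials_eq:
  "K_symmetric_potentials A B d =
    {\<xi> \<in> symmetric_space A B d. Im (Poly_Mapping.lookup \<xi> (-1) $ 1 $ 2) > 0}"
proof (intro set_eqI iffI)
  fix \<xi> assume "\<xi> \<in> K_symmetric_potentials A B d"
  then have keys: "Poly_Mapping.keys \<xi> \<subseteq> {-1..int d}"
    and sl: "\<forall>k\<in>{-1..int d}. Poly_Mapping.lookup \<xi> k \<in> sl2"
    and re: "\<forall>k\<in>{-1..int d}. Poly_Mapping.lookup \<xi> k =
        - conj_transpose (Poly_Mapping.lookup \<xi> (int d - k - 1))"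
    and K: "K_symmetric A B \<xi>"
    and "\<exists>r::real. r > 0 \<and>
        Poly_Mapping.lookup \<xi> (-1) = vector [vector [0, \<i> * complex_of_real r], vector [0, 0]]"
    unfolding K_symmetric_potentials_def potentials_def by blast+
  then obtain r where r: "r > 0"
    and lead: "Poly_Mapping.lookup \<xi> (-1) = vector [vector [0, \<i> * complex_of_real r], vector [0, 0]]"
    by blast
  define a where "a k = Poly_Mapping.lookup \<xi> k $ 1 $ 1" for k
  define b where "b k = Poly_Mapping.lookup \<xi> k $ 1 $ 2" for k
  have supp: "Poly_Mapping.lookup \<xi> k = 0" if "k \<notin> {-1..int d}" for k
    using that keys in_keys_iff[of k \<xi>] by blast
  \<comment> \<open>The reflection \<open>k \<mapsto> d - 1 - k\<close> preserves the range of
    exponents, so the reality condition extends to all \<open>k\<close>.\<close>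
  have re': "Poly_Mapping.lookup \<xi> k $ i $ j = - cnj (Poly_Mapping.lookup \<xi> (int d - 1 - k) $ j $ i)" for i j k
  proof (cases "k \<in> {-1..int d}")
    case True
    then have "Poly_Mapping.lookup \<xi> k $ i $ j = (- conj_transpose (Poly_Mapping.lookup \<xi> (int d - k - 1))) $ i $ j"
      using re by metis
    then show ?thesis by (simp add: conj_transpose_def algebra_simps)
  next
    case False
    then have "int d - 1 - k \<notin> {-1..int d}" by auto
    then show ?thesis using False supp by simp
  qed
  have e22: "Poly_Mapping.lookup \<xi> k $ 2 $ 2 = - a k" for k
  proof (cases "k \<in> {-1..int d}")
    case True
    then have "trace (Poly_Mapping.lookup \<xi> k) = 0" using sl by (auto simp: sl2_def)
    then show ?thesis by (simp add: trace_def sum_2 a_def eq_neg_iff_add_eq_0 add.commute)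
  qed (simp add: supp a_def)
  have lk: "Poly_Mapping.lookup \<xi> = potential_coeff d a b"
    using re'[of _ 2 1] e22 by (auto simp: fun_eq_iff vec_eq_iff forall_2 a_def b_def)
  have sym: "a k = - cnj (a (int d - 1 - k))" for k
    using re'[of k 1 1] by (simp add: a_def)
  \<comment> \<open>The reality condition carries the zero in the lower left corner of the leading
    coefficient to \<open>b d\<close>.\<close>
  have a1: "a (-1) = 0" and b1: "b (-1) = \<i> * r" and c1: "b (int d) = 0"
    using lead re'[of "int d" 1 2] by (simp_all add: a_def b_def)
  have ad: "a (int d) = 0" using sym[of "int d"] a1 by simp
  have sa: "a k = 0" if "k \<notin> {0..int d - 1}" for k
    using that a1 ad supp[of k] by (cases "k = -1 \<or> k = int d") (auto simp: a_def)
  have sb: "b k = 0" if "k \<notin> {-1..int d - 1}" for k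
    using that c1 supp[of k] by (cases "k = int d") (auto simp: b_def)
  \<comment> \<open>These are the lower right and the upper right equation, rewritten in
    \<open>a\<close> and \<open>b\<close>.\<close>
  have K2: "4 * of_real A * (a k + cnj (a k)) - 4 * of_real B * (a (k + 1) + cnj (a (k + 1)))
       = (b (k - 1) + cnj (b (k - 1))) - (b (k + 1) + cnj (b (k + 1))) \<and>
     4 * of_real A * b k - 4 * of_real B * b (k - 1)
       + (4 * of_real B * b (int d - 2 - k) - 4 * of_real A * b (int d - 1 - k))
       + ((cnj (a (k - 1)) - a (k - 1)) - (cnj (a (k + 1)) - a (k + 1))) = 0" for k
  proof (cases "k \<in> {-2..int d + 1}")
    case True
    have "int d - 1 - (k + 1) = int d - 2 - k" by simp
    then show ?thesis
      using True K K_symmetric_iff[OF keys, of A B] unfolding lk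
      by (auto simp: algebra_simps dest!: bspec[of _ _ k])
  next
    case False
    then show ?thesis by (auto simp: sa sb)
  qed
  have R: "Re (b (k - 1)) - Re (b (k + 1)) = 4 * A * Re (a k) - 4 * B * Re (a (k + 1))" for k
    using arg_cong[OF K2[THEN conjunct1, of k], of Re] by (simp add: algebra_simps)
  \<comment> \<open>Since \<open>cnj (a j) - a j\<close> is purely imaginary, the real part of the
    upper right equation involves \<open>b\<close> alone.\<close>
  have I: "A * (Re (b k) - Re (b (int d - 1 - k))) = B * (Re (b (k - 1)) - Re (b (int d - 2 - k)))"
    "Im (a (k - 1)) - Im (a (k + 1)) =
        2 * A * (Im (b k) - Im (b (int d - 1 - k))) - 2 * B * (Im (b (k - 1)) - Im (b (int d - 2 - k)))" for k
    using arg_cong[OF K2[THEN conjunct2, of k], of Re] arg_cong[OF K2[THEN conjunct2, of k], of Im] by (simp_all add: algebra_simps)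
  have b0: "Re (b (-1)) = 0" using b1 by simp
  have "admissible_entries A B d a b"
    unfolding admissible_entries_def
    by (intro conjI allI impI) ((rule sa sb b0 sym R I; assumption) | rule b0 sym R I)+
  then show "\<xi> \<in> {\<xi> \<in> symmetric_space A B d. Im (Poly_Mapping.lookup \<xi> (-1) $ 1 $ 2) > 0}"
    unfolding symmetric_space_def using lk b1 r by auto
next
  fix \<xi> assume "\<xi> \<in> {\<xi> \<in> symmetric_space A B d. Im (Poly_Mapping.lookup \<xi> (-1) $ 1 $ 2) > 0}"
  then obtain a b where adm: "admissible_entries A B d a b" and lk: "Poly_Mapping.lookup \<xi> = potential_coeff d a b"
    and pos: "Im (b (-1)) > 0"
    unfolding symmetric_space_def by auto
  note sa = admissible_entriesD(1)[OF adm] and sb = admissible_entriesD(2)[OF adm]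
    and sym = admissible_entriesD(4)[OF adm] and R = admissible_entriesD(5)[OF adm]
    and I = admissible_entriesD(6,7)[OF adm]
  have keys: "Poly_Mapping.keys \<xi> \<subseteq> {-1..int d}"
  proof
    fix k assume k: "k \<in> Poly_Mapping.keys \<xi>"
    show "k \<in> {-1..int d}"
    proof (rule ccontr)
      assume *: "k \<notin> {-1..int d}"
      then have "a k = 0" "b k = 0" "b (int d - 1 - k) = 0"
        by (auto intro!: sa sb)
      then show False using k by (simp add: in_keys_iff lk vec_eq_iff forall_2)
    qed
  qed
  have "Re (a k) = - Re (a (int d - 1 - k))" for k
    using arg_cong[OF sym[of k], of Re] by simp
  note S = this
  \<comment> \<open>The upper left equation is the lower right one reflected by
    \<open>k \<mapsto> d - 1 - k\<close>.\<close>
  have R': "Re (b (int d - 2 - k)) - Re (b (int d - k)) = 4 * B * Re (a (k - 1)) - 4 * A * Re (a k)" for k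
    using R[of "int d - 1 - k"] S[of k] S[of "k - 1"] by (simp add: algebra_simps)
  have "K_symmetric A B \<xi>"
    unfolding K_symmetric_iff[OF keys] lk
  proof (rule ballI, goal_cases)
    case (1 k)
    then show ?case using R[of k] I[of k] R'[of k] by (simp add: complex_eq_iff algebra_simps)
  qed
  moreover have "\<xi> \<in> potentials d"
  proof -
    have "b (-1) = \<i> * Im (b (-1))"
      using adm unfolding admissible_entries_def by (simp add: complex_eq_iff)
    then have "Poly_Mapping.lookup \<xi> (-1) = vector [vector [0, \<i> * complex_of_real (Im (b (-1)))], vector [0, 0]]"
      using sa[of "-1"] sb[of "int d"] by (simp add: lk vec_eq_iff forall_2)
    then have "\<exists>r>0. Poly_Mapping.lookup \<xi> (-1) = vector [vector [0, \<i> * complex_of_real r], vector [0, 0]]"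
      using pos by blast
    moreover have "Poly_Mapping.lookup \<xi> k = - conj_transpose (Poly_Mapping.lookup \<xi> (int d - k - 1))" for k
    proof -
      have e: "int d - k - 1 = int d - 1 - k" by simp
      have "cnj (a (int d - 1 - k)) = - a k" using sym[of k] by simp
      then show ?thesis unfolding e by (simp add: lk vec_eq_iff forall_2 conj_transpose_def)
    qed
    moreover have "Poly_Mapping.lookup \<xi> k \<in> sl2" for k
      by (simp add: lk sl2_def trace_def sum_2)
    ultimately show ?thesis
      unfolding potentials_def using keys by blast
  qed
  ultimately show "\<xi> \<in> K_symmetric_potentials A B d"
    by (simp add: K_symmetric_potentials_def)
qed

section \<open>Vanishing coordinates force a vanishing solution\<close>

text \<open>Steps of two carry the value at \<open>m\<close> unchanged into the region where
  \<open>u\<close> vanishes. This is how \<open>s f = 0\<close> is solved for \<open>f\<close> of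
  bounded support.\<close>

lemma zero_of_even_steps_below:
  fixes u :: "int \<Rightarrow> 'a::zero"
  assumes "\<And>k. k < l \<Longrightarrow> u k = 0" and "\<And>j::nat. u (m - 2 * int j) = u (m - 2 * int j - 2)"
  shows "u m = 0"
proof -
  have "u m = u (m - 2 * int j)" for j
    by (induction j) (use assms(2) in \<open>auto simp: algebra_simps\<close>)
  moreover have "m - 2 * int (nat (m - l) + 1) < l" by simp
  ultimately show ?thesis using assms(1) by metis
qed

lemma zero_of_even_steps_above:
  fixes u :: "int \<Rightarrow> 'a::zero"
  assumes "\<And>k. k > l \<Longrightarrow> u k = 0" and "\<And>j::nat. u (m + 2 * int j) = u (m + 2 * int j + 2)"
  shows "u m = 0"
proof -
  have "u (- (- m)) = 0"
    by (rule zero_of_even_steps_below[where l = "- l" and u = "\<lambda>k. u (- k)"])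
       (use assms in \<open>auto simp: algebra_simps\<close>)
  then show ?thesis by simp
qed

text \<open>For odd \<open>d\<close> the hypotheses cover all of \<open>Im b\<close>, and
  antisymmetry settles \<open>Re a\<close>. For even \<open>d\<close> the last coefficient of
  \<open>Im b\<close> and the middle pair of \<open>Re a\<close> remain; the conditions at
  \<open>\<lambda> = -1\<close> remove them because \<open>A + B\<close> is nonzero. The other parts
  then follow by division by \<open>s\<close>.\<close>

lemma admissible_entries_eq_0:
  assumes adm: "admissible_entries A B d a b" and d: "d \<ge> 1"
    and AB: "even d \<Longrightarrow> A + B \<noteq> 0"
    and g: "\<And>k. k < int d - 1 \<Longrightarrow> Im (b k) = 0"
    and g': "odd d \<Longrightarrow> Im (b (int d - 1)) = 0"
    and h: "\<And>k. k < int ((d - 1) div 2) \<Longrightarrow> Re (a k) = 0"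
  shows "a k = 0" and "b k = 0"
proof -
  note supp_a = admissible_entriesD(1)[OF adm] and supp_b = admissible_entriesD(2)[OF adm]
    and R = admissible_entriesD(5)[OF adm] and I = admissible_entriesD(7)[OF adm]
  have sym: "Re (a k) = - Re (a (int d - 1 - k))" for k
    using arg_cong[OF admissible_entriesD(4)[OF adm, of k], of Re] by simp
  have Imb0: "Im (b k) = 0" if "k \<noteq> int d - 1" for k
    using that g[of k] supp_b[of k] by (cases "k < int d - 1") auto
  have lead: "Im (b (int d - 1)) = 0"
  proof (cases "even d")
    case True
    then obtain p where p: "d = 2 * p" by blast
    \<comment> \<open>With \<open>t = Im (b (d - 1))\<close> the only remaining coefficient of
      \<open>Im b\<close>, the sequence \<open>Im a\<close> is constant on the odd exponents from 1
      to \<open>d - 1\<close>. Its values at the two ends are \<open>2 A t\<close> and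
      \<open>- 2 B t\<close>, so \<open>(A + B) t = 0\<close>.\<close>
    have chain: "Im (a (1 + 2 * int j)) = Im (a 1)" if "j \<le> p - 1" for j
      using that
    proof (induction j)
      case (Suc j)
      have "Im (a (2 * int (Suc j) - 1)) - Im (a (2 * int (Suc j) + 1)) = 0"
        unfolding I using Suc.prems p d by (subst Imb0, presburger)+ simp
      moreover have "2 * int (Suc j) - 1 = 1 + 2 * int j" "2 * int (Suc j) + 1 = 1 + 2 * int (Suc j)" by auto
      ultimately show ?case using Suc by simp
    qed simp
    have "Im (a 1) = 2 * A * Im (b (int d - 1))"
      using I[of 0] Imb0[of 0] Imb0[of "-1"] Imb0[of "int d - 2"] supp_a[of "-1"] p d by auto
    moreover have "Im (a (int d - 1)) = - 2 * B * Im (b (int d - 1))"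
      using I[of "int d"] Imb0[of "int d"] Imb0[of "-1"] Imb0[of "-2"] supp_a[of "int d + 1"] p d by auto
    moreover have "Im (a (int d - 1)) = Im (a 1)"
      using chain[of "p - 1"] p d by (simp add: algebra_simps)
    ultimately have "2 * A * Im (b (int d - 1)) = - 2 * B * Im (b (int d - 1))" by metis
    then have "(A + B) * Im (b (int d - 1)) = 0" by (simp add: distrib_right)
    then show ?thesis using AB True by simp
  qed (use g' in blast)
  have Imb: "Im (b k) = 0" for k using Imb0 lead by metis
  have Ima: "Im (a k) = 0" for k
  proof (rule zero_of_even_steps_below[where l = 0 and u = "\<lambda>k. Im (a k)"])
    show "Im (a (k - 2 * int j)) = Im (a (k - 2 * int j - 2))" for j
      using I[of "k - 2 * int j - 1"] by (simp add: Imb algebra_simps)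
  qed (simp add: supp_a)
  have Rea: "Re (a k) = 0" for k
  proof -
    have low: "Re (a k) = 0" if "k < int ((d - 1) div 2) \<or> k > int d - 1 - int ((d - 1) div 2)" for k
      using that h[of k] h[of "int d - 1 - k"] sym[of k] by auto
    show ?thesis
    proof (cases "even d")
      case True
      then obtain p where p: "d = 2 * p" by blast
      with d have p1: "p \<ge> 1" and dp: "int ((d - 1) div 2) = int p - 1" by auto
      have low': "Re (a k) = 0" if "k \<le> int p - 2 \<or> k \<ge> int p + 1" for k
        using low[of k] that p dp by auto
      \<comment> \<open>Away from the exponents \<open>p - 1\<close> and \<open>p\<close>,
        \<open>Re a\<close> vanishes. Hence \<open>Re b\<close> is zero at \<open>p - 2\<close>,
        reached from below, and at \<open>p\<close>, reached from above; the equation at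
        \<open>p - 1\<close> between them leaves \<open>(A + B) Re (a (p - 1)) = 0\<close>.\<close>
      have "Re (b (int p - 2)) = 0"
      proof (rule zero_of_even_steps_below[where l = "-1" and u = "\<lambda>k. Re (b k)"])
        show "Re (b (int p - 2 - 2 * int j)) = Re (b (int p - 2 - 2 * int j - 2))" for j
          using R[of "int p - 3 - 2 * int j"] low'[of "int p - 3 - 2 * int j"] low'[of "int p - 2 - 2 * int j"]
          by (simp add: algebra_simps)
      qed (simp add: supp_b)
      moreover have "Re (b (int p)) = 0"
      proof (rule zero_of_even_steps_above[where l = "int d" and u = "\<lambda>k. Re (b k)"])
        show "Re (b (int p + 2 * int j)) = Re (b (int p + 2 * int j + 2))" for j
          using R[of "int p + 1 + 2 * int j"] low'[of "int p + 1 + 2 * int j"] low'[of "int p + 2 + 2 * int j"]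
          by (simp add: algebra_simps)
      qed (simp add: supp_b)
      moreover have opp: "Re (a (int p)) = - Re (a (int p - 1))"
        using sym[of "int p"] p by (simp add: algebra_simps)
      ultimately have "(A + B) * Re (a (int p - 1)) = 0"
        using R[of "int p - 1"] by (simp add: algebra_simps)
      then have "Re (a (int p - 1)) = 0" using AB True by simp
      moreover consider "k = int p" | "k = int p - 1" | "k \<le> int p - 2 \<or> k \<ge> int p + 1" by linarith
      ultimately show ?thesis using opp low'[of k] by cases auto
    next
      case False
      then obtain p where p: "d = 2 * p + 1" using oddE by blast
      \<comment> \<open>The middle exponent is fixed by the reflection, so antisymmetry makes its
        coefficient zero.\<close>
      then have "Re (a (int p)) = 0" using sym[of "int p"] by (simp add: algebra_simps)
      then show ?thesis using low[of k] p by (cases "k = int p"; cases "k < int p") auto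
    qed
  qed
  have Reb: "Re (b k) = 0" for k
  proof (rule zero_of_even_steps_below[where l = "-1" and u = "\<lambda>k. Re (b k)"])
    show "Re (b (k - 2 * int j)) = Re (b (k - 2 * int j - 2))" for j
      using R[of "k - 2 * int j - 1"] by (simp add: Rea algebra_simps)
  qed (simp add: supp_b)
  show "a k = 0" "b k = 0" by (simp_all add: complex_eq_iff Rea Ima Reb Imb)
qed

section \<open>Explicit solutions of the coefficient equations\<close>

text \<open>Coefficients of \<open>(\<lambda>\<^sup>x - \<lambda>\<^sup>y) / (\<lambda> - \<lambda>\<^sup>-\<^sup>1)\<close> for \<open>x \<equiv> y\<close> modulo 2.\<close>

definition quotient_coeff :: "int \<Rightarrow> int \<Rightarrow> int \<Rightarrow> real" where
  "quotient_coeff x y k = (if odd (k - x) then of_bool (k > y) - of_bool (k > x) else 0)"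

text \<open>This is multiplication of the quotient by its denominator \<open>s\<close>, read off at
  the exponent \<open>k\<close>.\<close>

lemma quotient_coeff_diff:
  assumes "even (x - y)"
  shows "quotient_coeff x y (k - 1) - quotient_coeff x y (k + 1) = of_bool (k = x) - of_bool (k = y)"
proof (cases "even (k - x)")
  case True
  with assms have "k - 1 > x \<longleftrightarrow> k > x" "k + 1 > x \<longleftrightarrow> k > x \<or> k = x"
    "k - 1 > y \<longleftrightarrow> k > y" "k + 1 > y \<longleftrightarrow> k > y \<or> k = y"
    by presburger+
  then show ?thesis using True by (auto simp: quotient_coeff_def)
next
  case False
  with assms have "k \<noteq> x" "k \<noteq> y" by auto
  with False show ?thesis by (simp add: quotient_coeff_def)
qed

text \<open>Inverting \<open>\<lambda>\<close> changes the sign of the denominator, which swaps the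
  two reflected exponents.\<close>

lemma quotient_coeff_reflect:
  assumes "even (x - y)"
  shows "quotient_coeff x y (n - k) = quotient_coeff (n - y) (n - x) k"
proof (cases "even (n - k - x)")
  case False
  with assms have "n - k \<noteq> x" "n - k \<noteq> y" by auto
  then have "n - k > x \<longleftrightarrow> \<not> k > n - x" "n - k > y \<longleftrightarrow> \<not> k > n - y" by auto
  moreover have "odd (k - (n - y))" using False assms by presburger
  ultimately show ?thesis using False by (simp add: quotient_coeff_def of_bool_def)
next
  case True
  moreover have "even (k - (n - y))" using True assms by presburger
  ultimately show ?thesis by (simp add: quotient_coeff_def)
qed

lemma quotient_coeff_eq_0:
  assumes "even (x - y)" "k \<notin> {min x y<..<max x y}"
  shows "quotient_coeff x y k = 0"
proof (cases "even (k - x)")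
  case False
  with assms(1) have "k \<noteq> x" "k \<noteq> y" by auto
  with assms(2) show ?thesis by (auto simp: quotient_coeff_def)
qed (simp add: quotient_coeff_def)

lemma symmetric_space_element:
  assumes "admissible_entries A B d a b"
  obtains \<xi> where "\<xi> \<in> symmetric_space A B d" "Poly_Mapping.lookup \<xi> = potential_coeff d a b"
proof
  have "{k. potential_coeff d a b k \<noteq> 0} \<subseteq> {-1..int d}"
  proof
    fix k assume k: "k \<in> {k. potential_coeff d a b k \<noteq> 0}"
    show "k \<in> {-1..int d}"
    proof (rule ccontr)
      assume *: "k \<notin> {-1..int d}"
      then have "a k = 0" "b k = 0" "b (int d - 1 - k) = 0"
        by (auto intro!: admissible_entriesD(1,2)[OF assms])
      then show False using k by (simp add: vec_eq_iff forall_2)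
    qed
  qed
  then have "finite {k. potential_coeff d a b k \<noteq> 0}"
    using finite_subset by blast
  then show *: "Poly_Mapping.lookup (Abs_poly_mapping (potential_coeff d a b)) = potential_coeff d a b"
    by simp
  show "Abs_poly_mapping (potential_coeff d a b) \<in> symmetric_space A B d"
    unfolding symmetric_space_def using * assms by blast
qed

text \<open>Here \<open>a = s h\<close> and \<open>b = q h\<close> with \<open>h~ = h\<close>, so
  \<open>s b = q a\<close> is commutativity, and \<open>a~ = - a\<close> because \<open>s\<close> is
  odd under inversion of \<open>\<lambda>\<close>. The support of \<open>h\<close> keeps
  \<open>b (-1)\<close> equal to zero.\<close>

lemma admissible_entries_real:
  fixes h :: "int \<Rightarrow> real"
  assumes supp: "\<And>k. k \<notin> {1..int d - 2} \<Longrightarrow> h k = 0" and sym: "\<And>k. h (int d - 1 - k) = h k"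
  shows "admissible_entries A B d (\<lambda>k. of_real (h (k - 1) - h (k + 1)))
           (\<lambda>k. of_real (4 * A * h k - 4 * B * h (k + 1)))"
  unfolding admissible_entries_def
proof (intro conjI allI impI, goal_cases)
  \<comment> \<open>Both \<open>p b\<close> and \<open>q b~\<close> equal \<open>p q h\<close>,
    since reflection exchanges \<open>p\<close> and \<open>q\<close>.\<close>
  case (6 k)
  have "h (int d - 1 - k) = h k" "h (int d - 2 - k) = h (k + 1)" "h (int d - k) = h (k - 1)"
    using sym[of k] sym[of "k + 1"] sym[of "k - 1"] by (simp_all add: algebra_simps)
  moreover have "int d - 1 - k + 1 = int d - k" "int d - 2 - k + 1 = int d - 1 - k" by auto
  ultimately show ?case by (simp add: algebra_simps)
next
  case (4 k)
  have "h (int d - 1 - k - 1) = h (k + 1)" "h (int d - 1 - k + 1) = h (k - 1)"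
    using sym[of "k + 1"] sym[of "k - 1"] by (simp_all add: algebra_simps)
  then show ?case by (simp only: complex_cnj_diff complex_cnj_complex_of_real of_real_diff minus_diff_eq)
next
  case (1 k)
  then have "h (k - 1) = 0" "h (k + 1) = 0" by (auto intro!: supp)
  then show ?case by simp
next
  case (2 k)
  then have "h k = 0" "h (k + 1) = 0" by (auto intro!: supp)
  then show ?case by simp
qed (simp_all add: supp algebra_simps)

lemma admissible_entries_imaginary:
  fixes g u :: "int \<Rightarrow> real"
  assumes "\<And>k. k \<notin> {-1..int d - 1} \<Longrightarrow> g k = 0" "\<And>k. k \<notin> {0..int d - 1} \<Longrightarrow> u k = 0"
    and "\<And>k. u (int d - 1 - k) = u k"
    and "\<And>k. u (k - 1) - u (k + 1) =
      2 * A * (g k - g (int d - 1 - k)) - 2 * B * (g (k - 1) - g (int d - 2 - k))"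
  shows "admissible_entries A B d (\<lambda>k. \<i> * of_real (u k)) (\<lambda>k. \<i> * of_real (g k))"
  unfolding admissible_entries_def using assms by simp

text \<open>For \<open>Im b = \<lambda>^m\<close> the right-hand side
  \<open>p Im b - q (Im b)~\<close> is \<open>4 A (\<lambda>^m - \<lambda>^(d-1-m)) - 4 B
  (\<lambda>^(m+1) - \<lambda>^(d-2-m))\<close>. For odd \<open>d\<close> the exponents in each
  bracket have equal parity, so both brackets are divisible by \<open>s\<close>; half of the
  quotient is \<open>Im a\<close>.\<close>

lemma imaginary_solution_odd:
  assumes d: "odd d" and m: "m \<in> {-1..int d - 1}"
  shows "\<exists>a. admissible_entries A B d a (\<lambda>k. \<i> * of_real (of_bool (k = m)))"
proof -
  let ?q = quotient_coeff
  define u where "u k = 2 * A * ?q m (int d - 1 - m) k - 2 * B * ?q (m + 1) (int d - 2 - m) k" for k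
  have ev: "even (m - (int d - 1 - m))" "even (m + 1 - (int d - 2 - m))" using d by presburger+
  have "admissible_entries A B d (\<lambda>k. \<i> * of_real (u k)) (\<lambda>k. \<i> * of_real (of_bool (k = m)))"
  proof (rule admissible_entries_imaginary)
    show "of_bool (k = m) = (0::real)" if "k \<notin> {-1..int d - 1}" for k using that m by auto
    \<comment> \<open>All four exponents lie in \<open>{-1..d}\<close>, and a quotient is supported
      strictly between its two exponents.\<close>
    show "u k = 0" if k: "k \<notin> {0..int d - 1}" for k
    proof -
      have 1: "?q m (int d - 1 - m) k = 0" using m k by (intro quotient_coeff_eq_0[OF ev(1)]) auto
      have 2: "?q (m + 1) (int d - 2 - m) k = 0"
        using m k by (intro quotient_coeff_eq_0[OF ev(2)]) auto
      show ?thesis unfolding u_def 1 2 by simp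
    qed
    show "u (int d - 1 - k) = u k" for k
      unfolding u_def quotient_coeff_reflect[OF ev(1)] quotient_coeff_reflect[OF ev(2)] by (simp add: algebra_simps)
    show "u (k - 1) - u (k + 1) = 2 * A * (of_bool (k = m) - of_bool (int d - 1 - k = m))
        - 2 * B * (of_bool (k - 1 = m) - of_bool (int d - 2 - k = m))" for k
    proof -
      have e: "(int d - 1 - k = m) = (k = int d - 1 - m)" "(k - 1 = m) = (k = m + 1)"
        "(int d - 2 - k = m) = (k = int d - 2 - m)" by auto
      have "u (k - 1) - u (k + 1) =
          2 * A * (?q m (int d - 1 - m) (k - 1) - ?q m (int d - 1 - m) (k + 1))
          - 2 * B * (?q (m + 1) (int d - 2 - m) (k - 1) - ?q (m + 1) (int d - 2 - m) (k + 1))"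
        by (simp add: u_def algebra_simps)
      then show ?thesis unfolding quotient_coeff_diff[OF ev(1)] quotient_coeff_diff[OF ev(2)] e .
    qed
  qed
  then show ?thesis by blast
qed

text \<open>For even \<open>d\<close> a single monomial pairs exponents of opposite parity. The
  choice \<open>Im b = \<lambda>^m (1 + \<lambda>)\<close>, which vanishes at
  \<open>\<lambda> = -1\<close>, allows the terms to be regrouped into pairs of equal
  parity.\<close>

lemma imaginary_solution_even:
  assumes d: "even d" and m: "m \<in> {-1..int d - 2}"
  shows "\<exists>a. admissible_entries A B d a (\<lambda>k. \<i> * of_real (of_bool (k = m) + of_bool (k = m + 1)))"
proof -
  let ?q = quotient_coeff
  \<comment> \<open>\<open>v n\<close> is the quotient by \<open>s\<close> of \<open>g - g~\<close>
    for \<open>g = \<lambda>^n + \<lambda>^(n+1)\<close>, with the crosswise pairing;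
    \<open>n = m\<close> gives the part with \<open>A\<close>, \<open>n = m + 1\<close> the part
    with \<open>B\<close>.\<close>
  define v where "v n k = ?q n (int d - 2 - n) k + ?q (n + 1) (int d - 1 - n) k" for n k
  define u where "u k = 2 * A * v m k - 2 * B * v (m + 1) k" for k
  have ev: "even (n - (int d - 2 - n))" "even (n + 1 - (int d - 1 - n))" for n using d by presburger+
  have v_refl: "v n (int d - 1 - k) = v n k" for n k
    unfolding v_def quotient_coeff_reflect[OF ev(1)] quotient_coeff_reflect[OF ev(2)] by (simp add: algebra_simps)
  have v_diff: "v n (k - 1) - v n (k + 1) =
      of_bool (k = n) + of_bool (k = n + 1) - of_bool (k = int d - 2 - n) - of_bool (k = int d - 1 - n)" for n k
    using quotient_coeff_diff[OF ev(1), of n k] quotient_coeff_diff[OF ev(2), of n k]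
    by (simp add: v_def)
  have "admissible_entries A B d (\<lambda>k. \<i> * of_real (u k))
      (\<lambda>k. \<i> * of_real (of_bool (k = m) + of_bool (k = m + 1)))"
  proof (rule admissible_entries_imaginary)
    show "of_bool (k = m) + of_bool (k = m + 1) = (0::real)" if "k \<notin> {-1..int d - 1}" for k using that m by auto
    show "u (int d - 1 - k) = u k" for k by (simp add: u_def v_refl)
    show "u k = 0" if k: "k \<notin> {0..int d - 1}" for k
    proof -
      have "v n k = 0" if "n \<in> {m, m + 1}" for n
      proof -
        have "?q n (int d - 2 - n) k = 0" "?q (n + 1) (int d - 1 - n) k = 0"
          using m k that by (auto intro!: quotient_coeff_eq_0 ev)
        then show ?thesis by (simp add: v_def)
      qed
      then show ?thesis by (simp add: u_def)
    qed
    show "u (k - 1) - u (k + 1) =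
        2 * A * (of_bool (k = m) + of_bool (k = m + 1) - (of_bool (int d - 1 - k = m) + of_bool (int d - 1 - k = m + 1)))
        - 2 * B * (of_bool (k - 1 = m) + of_bool (k - 1 = m + 1) - (of_bool (int d - 2 - k = m) + of_bool (int d - 2 - k = m + 1)))" for k
    proof -
      have "u (k - 1) - u (k + 1) = 2 * A * (v m (k - 1) - v m (k + 1)) - 2 * B * (v (m + 1) (k - 1) - v (m + 1) (k + 1))"
        by (simp add: u_def algebra_simps)
      then show ?thesis unfolding v_diff by (auto simp: of_bool_def)
    qed
  qed
  then show ?thesis by blast
qed

section \<open>Coordinates and the dimension count\<close>

text \<open>The coefficients of \<open>Im b\<close> come first, starting at exponent -1, then those
  of \<open>Re a\<close>, starting at 0. In this order the explicit solutions are
  triangular.\<close>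

definition potential_coordinate :: "nat \<Rightarrow> nat \<Rightarrow> laurent \<Rightarrow> real" where
  "potential_coordinate N i \<xi> =
     (if i < N then Im (Poly_Mapping.lookup \<xi> (int i - 1) $ 1 $ 2)
      else Re (Poly_Mapping.lookup \<xi> (int (i - N)) $ 1 $ 1))"

lemma linear_potential_coordinate: "linear (potential_coordinate N i)"
  by (rule linearI) (simp_all add: potential_coordinate_def lookup_add lookup_scaleR_poly_mapping)

text \<open>\<open>N\<close> counts the solutions with imaginary \<open>b\<close>: one for each of
  the \<open>d + 1\<close> exponents of \<open>b\<close> if \<open>d\<close> is odd, one for each
  adjacent pair of exponents if \<open>d\<close> is even. The remaining \<open>(d - 1) div 2\<close>
  solutions have real \<open>a\<close> and \<open>b\<close>, so their first \<open>N\<close>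
  coordinates vanish.\<close>

lemma symmetric_space_basis:
  assumes d: "d \<ge> 1" and AB: "even d \<Longrightarrow> A + B \<noteq> 0"
  defines "N \<equiv> if even d then d else d + 1"
  shows "\<exists>b. finite b \<and> independent b \<and> card b = N + (d - 1) div 2 \<and> span b = symmetric_space A B d"
proof -
  let ?f = "potential_coordinate N"
  have "\<exists>e. e \<in> symmetric_space A B d \<and> ?f i e \<noteq> 0 \<and> (\<forall>j<i. ?f j e = 0)"
    if i: "i < N + (d - 1) div 2" for i
  proof (cases "i < N")
    case True
    have "\<exists>a g. admissible_entries A B d a (\<lambda>k. \<i> * of_real (g k)) \<and> g (int i - 1) \<noteq> 0 \<and> (\<forall>k<int i - 1. g k = 0)"
    proof (cases "even d")
      case ev: True
      have "int i - 1 \<in> {-1..int d - 2}" using True ev by (simp add: N_def)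
      then obtain a where "admissible_entries A B d a
          (\<lambda>k. \<i> * of_real (of_bool (k = int i - 1) + of_bool (k = int i - 1 + 1)))"
        using imaginary_solution_even[OF ev] by blast
      then show ?thesis
        by (intro exI[of _ a] exI[of _ "\<lambda>k. of_bool (k = int i - 1) + of_bool (k = int i - 1 + 1)"]) auto
    next
      case odd: False
      have "int i - 1 \<in> {-1..int d - 1}" using True odd by (simp add: N_def)
      then obtain a where "admissible_entries A B d a (\<lambda>k. \<i> * of_real (of_bool (k = int i - 1)))"
        using imaginary_solution_odd[OF odd] by blast
      then show ?thesis
        by (intro exI[of _ a] exI[of _ "\<lambda>k. of_bool (k = int i - 1)"]) auto
    qed
    then obtain a g where adm: "admissible_entries A B d a (\<lambda>k. \<i> * of_real (g k))"
      and g: "g (int i - 1) \<noteq> 0" "\<forall>k<int i - 1. g k = 0" by blast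
    obtain e where e: "e \<in> symmetric_space A B d"
      "Poly_Mapping.lookup e = potential_coeff d a (\<lambda>k. \<i> * of_real (g k))"
      by (rule symmetric_space_element[OF adm])
    then show ?thesis using True g by (intro exI[of _ e]) (auto simp: potential_coordinate_def)
  next
    case False
    define m where "m = int (i - N) + 1"
    have m: "1 \<le> m" "2 * m \<le> int d - 1" using i False d by (auto simp: m_def)
    \<comment> \<open>The lowest exponent of the symmetric \<open>h\<close> is \<open>m\<close>, so
      \<open>a = s h\<close> begins at \<open>m - 1 = i - N\<close>, the exponent read by coordinate
      \<open>i\<close>. If \<open>m = d - 1 - m\<close>, the two terms add up to 2 and do not
      cancel.\<close>
    define h :: "int \<Rightarrow> real" where "h k = of_bool (k = m) + of_bool (k = int d - 1 - m)" for k
    have adm: "admissible_entries A B d (\<lambda>k. of_real (h (k - 1) - h (k + 1)))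
           (\<lambda>k. of_real (4 * A * h k - 4 * B * h (k + 1)))"
      by (rule admissible_entries_real) (use m in \<open>auto simp: h_def\<close>)
    obtain e where e: "e \<in> symmetric_space A B d"
      "Poly_Mapping.lookup e = potential_coeff d (\<lambda>k. of_real (h (k - 1) - h (k + 1)))
           (\<lambda>k. of_real (4 * A * h k - 4 * B * h (k + 1)))"
      by (rule symmetric_space_element[OF adm])
    have "h (m - 2) - h m \<noteq> 0" using m by (auto simp: h_def)
    then have "?f i e \<noteq> 0" using False e(2) by (simp add: potential_coordinate_def m_def)
    moreover have "?f j e = 0" if "j < i" for j
    proof (cases "j < N")
      case jN: False
      then have "h (int (j - N) - 1) = 0" "h (int (j - N) + 1) = 0"
        using that m by (auto simp: h_def m_def)
      then show ?thesis using jN e(2) by (simp add: potential_coordinate_def)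
    qed (simp add: potential_coordinate_def e(2))
    ultimately show ?thesis using e(1) by blast
  qed
  then obtain e where e: "\<And>i. i < N + (d - 1) div 2 \<Longrightarrow>
      e i \<in> symmetric_space A B d \<and> ?f i (e i) \<noteq> 0 \<and> (\<forall>j<i. ?f j (e i) = 0)"
    by metis
  show ?thesis
  proof (rule triangular_coordinates_basis[where e = e and f = ?f])
    fix x assume "x \<in> symmetric_space A B d" and 0: "\<forall>i<N + (d - 1) div 2. ?f i x = 0"
    then obtain a b where adm: "admissible_entries A B d a b" and x: "Poly_Mapping.lookup x = potential_coeff d a b"
      unfolding symmetric_space_def by blast
    have g: "Im (b k) = 0" if "k < int N - 1" for k
    proof (cases "k < -1")
      case True
      then show ?thesis using admissible_entriesD(2)[OF adm, of k] by simp
    next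
      case False
      with that have "nat (k + 1) < N" "int (nat (k + 1)) - 1 = k" by auto
      then show ?thesis using 0[rule_format, of "nat (k + 1)"] x
        by (simp add: potential_coordinate_def)
    qed
    have g1: "Im (b k) = 0" if "k < int d - 1" for k using g[of k] that by (simp add: N_def split: if_splits)
    have g2: "Im (b (int d - 1)) = 0" if "odd d" using g[of "int d - 1"] that by (simp add: N_def)
    have h: "Re (a k) = 0" if "k < int ((d - 1) div 2)" for k
    proof (cases "k < 0")
      case True
      then show ?thesis using admissible_entriesD(1)[OF adm, of k] by simp
    next
      case False
      with that have "nat k < (d - 1) div 2" "int (nat k) = k" by auto
      then show ?thesis using 0[rule_format, of "N + nat k"] x
        by (simp add: potential_coordinate_def)
    qed
    note z = admissible_entries_eq_0[OF adm d AB g1 g2 h]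
    have "a k = 0" "b k = 0" for k by (rule z; assumption)+
    then show "x = 0" by (intro poly_mapping_eqI) (simp add: x vec_eq_iff forall_2)
  qed (use e subspace_symmetric_space linear_potential_coordinate in auto)
qed

lemma real_dimensional_K_symmetric_potentials:
  assumes d: "d \<ge> 1"
    and b: "finite b" "independent b" "card b = n" "span b = symmetric_space A B d"
  shows "real_dimensional n (K_symmetric_potentials A B d)"
proof -
  let ?U = "{\<xi> :: laurent. Im (Poly_Mapping.lookup \<xi> (-1) $ 1 $ 2) > 0}"
  have eq: "K_symmetric_potentials A B d = symmetric_space A B d \<inter> ?U"
    using K_symmetric_potentials_eq by auto
  have "continuous_on UNIV (\<lambda>\<xi> :: laurent. Poly_Mapping.lookup \<xi> (-1))"
    by (intro linear_continuous_on bounded_linear_lookup)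
  then have "open ?U"
    by (intro open_Collect_less continuous_intros) auto
  then have "openin (top_of_set (span b)) (K_symmetric_potentials A B d)"
    unfolding eq b(4) by (auto simp: openin_open)
  moreover have "K_symmetric_potentials A B d \<noteq> {}"
  proof -
    \<comment> \<open>The imaginary solution with \<open>m = -1\<close> has leading coefficient
      \<open>\<i>\<close>.\<close>
    have "\<exists>a g. admissible_entries A B d a (\<lambda>k. \<i> * of_real (g k)) \<and> g (-1) > 0"
    proof (cases "even d")
      case True
      have "-1 \<in> {-1..int d - 2}" using d True by auto
      then obtain a where "admissible_entries A B d a
          (\<lambda>k. \<i> * of_real (of_bool (k = -1) + of_bool (k = -1 + 1)))"
        using imaginary_solution_even[OF True] by blast
      then show ?thesis
        by (intro exI[of _ a] exI[of _ "\<lambda>k. of_bool (k = -1) + of_bool (k = -1 + 1)"]) auto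
    next
      case False
      have "-1 \<in> {-1..int d - 1}" by auto
      then obtain a where "admissible_entries A B d a (\<lambda>k. \<i> * of_real (of_bool (k = -1)))"
        using imaginary_solution_odd[OF False] by blast
      then show ?thesis
        by (intro exI[of _ a] exI[of _ "\<lambda>k. of_bool (k = -1)"]) auto
    qed
    then obtain a g where adm: "admissible_entries A B d a (\<lambda>k. \<i> * of_real (g k))" and g: "g (-1) > 0"
      by blast
    obtain e where "e \<in> symmetric_space A B d"
      "Poly_Mapping.lookup e = potential_coeff d a (\<lambda>k. \<i> * of_real (g k))"
      by (rule symmetric_space_element[OF adm])
    then have "e \<in> K_symmetric_potentials A B d" using g by (simp add: eq)
    then show ?thesis by blast
  qed
  ultimately show ?thesis
    unfolding real_dimensional_def using b by blast
qed

theorem theorem2p5: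
  fixes A B :: real and d :: nat
  assumes "d \<ge> 1"
  shows "(even d \<longrightarrow> A + B \<noteq> 0 \<longrightarrow>
            real_dimensional ((3 * d - 2) div 2) (K_symmetric_potentials A B d)) \<and>
         (odd d \<longrightarrow>
            real_dimensional ((3 * d + 1) div 2) (K_symmetric_potentials A B d))"
proof (intro conjI impI)
  assume "even d" "A + B \<noteq> 0"
  \<comment> \<open>Here \<open>(d - 1) div 2\<close> is \<open>d / 2 - 1\<close>, one less than the
    number of antisymmetric pairs in \<open>Re a\<close>, because of the condition at
    \<open>\<lambda> = -1\<close>.\<close>
  moreover from this assms have "d + (d - 1) div 2 = (3 * d - 2) div 2" by presburger
  ultimately obtain b where "finite b" "independent b" "card b = (3 * d - 2) div 2"
    "span b = symmetric_space A B d"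
    using symmetric_space_basis[OF assms, where A = A and B = B] by auto
  then show "real_dimensional ((3 * d - 2) div 2) (K_symmetric_potentials A B d)"
    by (rule real_dimensional_K_symmetric_potentials[OF assms])
next
  assume "odd d"
  moreover from this have "d + 1 + (d - 1) div 2 = (3 * d + 1) div 2" by presburger
  ultimately obtain b where "finite b" "independent b" "card b = (3 * d + 1) div 2"
    "span b = symmetric_space A B d"
    using symmetric_space_basis[OF assms, where A = A and B = B] by auto
  then show "real_dimensional ((3 * d + 1) div 2) (K_symmetric_potentials A B d)"
    by (rule real_dimensional_K_symmetric_potentials[OF assms])
qed

end
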